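(* Let $(v(x,t),b(x,t))$ be a smooth solution on $\mathbb{R}^3\times[0,T)$, $T\in(0,\infty]$, of the ideal magnetohydrodynamic equations $$\frac{\partial v}{\partial t}+(v\cdot\nabla)v=-\nabla p-b\times\operatorname{curl}b,\qquad\frac{\partial b}{\partial t}+(v\cdot\nabla)b=(b\cdot\nabla)v,\qquad\operatorname{div}v=\operatorname{div}b=0,$$ $v(x,0)=v_0(x)$, $b(x,0)=b_0(x)$, with $\|b_0\|_{L^\infty}<\infty$. Let $\{X(\cdot,t)\}$ be the particle trajectory map and $A(\cdot,t)$ the back-to-label map generated by $v$. Set $\xi(x,t)=\frac{b(x,t)}{|b(x,t)|}$ (where $b\ne0$), and let $\{(\lambda_j(x,t),e_j(x,t))\}_{j=1}^3$ be the pairs of eigenvalues and normalized (orthonormal) eigenvectors of $M(x,t)=(\nabla A(x,t))^T\nabla A(x,t)$, ordered so that $\lambda_1(x,t)\ge\lambda_2(x,t)\ge\lambda_3(x,t)>0$. Suppose there exists a sequence $\{(x_k,t_k)\}$ in $\mathbb{R}^3\times[0,T)$ tending to some $(\bar x,\bar t)\in\mathbb{R}^3\times[0,T]$ as $k\to\infty$ such that $\lim_{k\to\infty}|b(x_k,t_k)|=\infty$. Then necessarily $$\lim_{k\to\infty}\lambda_1(x_k,t_k)=\infty\quad\text{and}\quad\lim_{k\to\infty}\lambda_3(x_k,t_k)=0,$$ and $$\lim_{k\to\infty}\xi(x_k,t_k)\cdot e_1(x_k,t_k)=0 .$$ Furthermore, if $\liminf_{k\to\infty}\lambda_2(x_k,t_k)>0$,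 then $$\lim_{k\to\infty}\xi(x_k,t_k)\cdot e_2(x_k,t_k)=0 .$$
   Context: $v=(v_1,v_2,v_3)$ is the velocity, $p=p(x,t)$ the scalar pressure, $b=(b_1,b_2,b_3)$ the magnetic field, and $\operatorname{div}v_0=\operatorname{div}b_0=0$. The particle trajectory map $X(\cdot,t)$ generated by $v$ is defined by $\frac{\partial X(a,t)}{\partial t}=v(X(a,t),t)$, $X(a,0)=a\in\mathbb{R}^3$; for each $t\in[0,T)$ it is a diffeomorphism of $\mathbb{R}^3$ (standing assumption), and the back-to-label map is its inverse $A(\cdot,t)=X^{-1}(\cdot,t)$. $\nabla A$ is the Jacobian matrix of $A(\cdot,t)$. *)

theory Defs
  imports "HOL-Analysis.Analysis" "HOL-Probability.Essential_Supremum"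
begin

section \<open>Smooth maps\<close>

text \<open>
  Only sets \<open>S\<close> on which derivatives within \<open>S\<close> are unique are intended, such as the whole
  space or \<open>\<real>\<^sup>3 \<times> [0,T)\<close>; on the latter the derivative is one-sided in time at \<open>t = 0\<close>.
  The iterated directional derivatives stand for the higher Frechet derivatives, which in finite
  dimension gives the usual notion of a \<open>C\<^sup>k\<close> map.
\<close>

primrec Ck_on :: "nat \<Rightarrow> 'a::euclidean_space set \<Rightarrow> ('a \<Rightarrow> 'b::euclidean_space) \<Rightarrow> bool" where
  "Ck_on 0 S f \<longleftrightarrow> continuous_on S f"
| "Ck_on (Suc k) S f \<longleftrightarrow>
     f differentiable_on S \<and> (\<forall>h. Ck_on k S (\<lambda>x. frechet_derivative f (at x within S) h))"

definition smooth_on :: "'a::euclidean_space set \<Rightarrow> ('a \<Rightarrow> 'b::euclidean_space) \<Rightarrow> bool" where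
  "smooth_on S f \<longleftrightarrow> (\<forall>k. Ck_on k S f)"

definition diffeomorphism :: "('a::euclidean_space \<Rightarrow> 'a) \<Rightarrow> bool" where
  "diffeomorphism f \<longleftrightarrow> bij f \<and> smooth_on UNIV f \<and> smooth_on UNIV (inv f)"


section \<open>Vector calculus on \<open>\<real>\<^sup>3\<close>\<close>

text \<open>In the library, \<open>jacobian f (at x) $ i $ j\<close> is the partial derivative of \<open>f\<^sub>i\<close> in \<open>x\<^sub>j\<close>.\<close>

definition gradient :: "(real^3 \<Rightarrow> real) \<Rightarrow> real^3 \<Rightarrow> real^3" where
  "gradient q x = (\<chi> i. frechet_derivative q (at x) (axis i 1))"

definition divergence :: "(real^3 \<Rightarrow> real^3) \<Rightarrow> real^3 \<Rightarrow> real" where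
  "divergence f x = (\<Sum>i\<in>UNIV. jacobian f (at x) $ i $ i)"

definition curl :: "(real^3 \<Rightarrow> real^3) \<Rightarrow> real^3 \<Rightarrow> real^3" where
  "curl f x = (let J = jacobian f (at x) in
     vector [J $ 3 $ 2 - J $ 2 $ 3, J $ 1 $ 3 - J $ 3 $ 1, J $ 2 $ 1 - J $ 1 $ 2])"

text \<open>\<open>convective u f x\<close> is \<open>(u \<sqdot> \<nabla>) f\<close> at \<open>x\<close>.\<close>

definition convective :: "(real^3 \<Rightarrow> real^3) \<Rightarrow> (real^3 \<Rightarrow> real^3) \<Rightarrow> real^3 \<Rightarrow> real^3" where
  "convective u f x = (\<chi> i. \<Sum>j\<in>UNIV. u x $ j * jacobian f (at x) $ i $ j)"


section \<open>Ideal magnetohydrodynamics\<close>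

text \<open>The interval \<open>[0,T)\<close>, where \<open>T = \<infinity>\<close> is allowed.\<close>

definition time_interval :: "ereal \<Rightarrow> real set" where
  "time_interval T = {t. 0 \<le> t \<and> ereal t < T}"

definition time_deriv :: "ereal \<Rightarrow> (real^3 \<Rightarrow> real \<Rightarrow> real^3) \<Rightarrow> real^3 \<Rightarrow> real \<Rightarrow> real^3" where
  "time_deriv T u x t = vector_derivative (u x) (at t within time_interval T)"

text \<open>
  The pressure enters only through its spatial gradient and is determined only up to a function
  of time, so for it just differentiability in space is required.
\<close>

definition smooth_ideal_mhd_solution ::
  "ereal \<Rightarrow> (real^3 \<Rightarrow> real^3) \<Rightarrow> (real^3 \<Rightarrow> real^3) \<Rightarrow> (real^3 \<Rightarrow> real \<Rightarrow> real^3) \<Rightarrow>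
   (real^3 \<Rightarrow> real \<Rightarrow> real^3) \<Rightarrow> (real^3 \<Rightarrow> real \<Rightarrow> real) \<Rightarrow> bool" where
  "smooth_ideal_mhd_solution T v0 b0 v b p \<longleftrightarrow>
     smooth_on (UNIV \<times> time_interval T) (\<lambda>(x, t). v x t) \<and>
     smooth_on (UNIV \<times> time_interval T) (\<lambda>(x, t). b x t) \<and>
     (\<forall>t \<in> time_interval T. (\<lambda>y. p y t) differentiable_on UNIV) \<and>
     (\<forall>x. \<forall>t \<in> time_interval T.
        time_deriv T v x t + convective (\<lambda>y. v y t) (\<lambda>y. v y t) x
          = - gradient (\<lambda>y. p y t) x - cross3 (b x t) (curl (\<lambda>y. b y t) x) \<and>
        time_deriv T b x t + convective (\<lambda>y. v y t) (\<lambda>y. b y t) x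
          = convective (\<lambda>y. b y t) (\<lambda>y. v y t) x \<and>
        divergence (\<lambda>y. v y t) x = 0 \<and>
        divergence (\<lambda>y. b y t) x = 0) \<and>
     (\<forall>x. v x 0 = v0 x \<and> b x 0 = b0 x)"

definition particle_trajectory_map ::
  "ereal \<Rightarrow> (real^3 \<Rightarrow> real \<Rightarrow> real^3) \<Rightarrow> (real^3 \<Rightarrow> real \<Rightarrow> real^3) \<Rightarrow> bool" where
  "particle_trajectory_map T v X \<longleftrightarrow>
     (\<forall>a. X a 0 = a \<and>
       (\<forall>t \<in> time_interval T.
          (X a has_vector_derivative v (X a t) t) (at t within time_interval T)))"

definition back_to_label_map :: "(real^3 \<Rightarrow> real \<Rightarrow> real^3) \<Rightarrow> real^3 \<Rightarrow> real \<Rightarrow> real^3" where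
  "back_to_label_map X x t = inv (\<lambda>a. X a t) x"

definition label_gram_matrix :: "(real^3 \<Rightarrow> real \<Rightarrow> real^3) \<Rightarrow> real^3 \<Rightarrow> real \<Rightarrow> real^3^3" where
  "label_gram_matrix A x t =
     transpose (jacobian (\<lambda>y. A y t) (at x)) ** jacobian (\<lambda>y. A y t) (at x)"

definition magnetic_direction :: "(real^3 \<Rightarrow> real \<Rightarrow> real^3) \<Rightarrow> real^3 \<Rightarrow> real \<Rightarrow> real^3" where
  "magnetic_direction b x t = b x t /\<^sub>R norm (b x t)"

text \<open>
  The index type \<open>3\<close> has the three distinct elements \<open>1, 2, 3\<close>; its order is not used
  (\<open>3 = 0\<close> in it).
\<close>

definition ordered_eigenframe :: "real^3^3 \<Rightarrow> (3 \<Rightarrow> real) \<Rightarrow> (3 \<Rightarrow> real^3) \<Rightarrow> bool" where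
  "ordered_eigenframe M lam e \<longleftrightarrow>
     (\<forall>j. M *v e j = lam j *\<^sub>R e j) \<and>
     (\<forall>i j. e i \<bullet> e j = (if i = j then 1 else 0)) \<and>
     lam 1 \<ge> lam 2 \<and> lam 2 \<ge> lam 3 \<and> lam 3 > 0"

end

theory Submission
  imports Defs
begin

text \<open>
  Along a trajectory both \<open>\<nabla>X b\<^sub>0\<close> and \<open>b\<close> solve \<open>w' = \<nabla>v w\<close> with the same initial value, so
  \<open>\<nabla>A b = b\<^sub>0 \<circ> A\<close>, which is bounded by \<open>C = \<parallel>b\<^sub>0\<parallel>\<^sub>\<infinity>\<close>; and \<open>det \<nabla>A = 1\<close> by incompressibility.
  Expanding \<open>|\<nabla>A b|\<^sup>2 = b \<sqdot> M b\<close> in the eigenframe gives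
  \<open>\<lambda>\<^sub>1 (\<xi> \<sqdot> e\<^sub>1)\<^sup>2 + \<lambda>\<^sub>2 (\<xi> \<sqdot> e\<^sub>2)\<^sup>2 + \<lambda>\<^sub>3 (\<xi> \<sqdot> e\<^sub>3)\<^sup>2 \<le> C\<^sup>2 / |b|\<^sup>2\<close>. Hence \<open>\<lambda>\<^sub>3 \<le> C\<^sup>2 / |b|\<^sup>2\<close>, and
  \<open>\<lambda>\<^sub>1\<^sup>2 \<lambda>\<^sub>3 \<ge> \<lambda>\<^sub>1 \<lambda>\<^sub>2 \<lambda>\<^sub>3 = 1\<close> forces \<open>\<lambda>\<^sub>1 \<ge> |b| / C\<close>; the bounds on \<open>\<xi> \<sqdot> e\<^sub>1\<close> and
  \<open>\<xi> \<sqdot> e\<^sub>2\<close> are read off the same sum.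
\<close>

section \<open>Growth of solutions of differential inequalities\<close>

text \<open>
  The growth condition is only required inside the unit ball; smallness of the initial value
  keeps the solution there. This replaces a global Lipschitz bound on the velocity.
\<close>

lemma gronwall_local:
  fixes u u' :: "real \<Rightarrow> 'a::real_inner"
  assumes der: "\<And>t. t \<in> {0..\<tau>} \<Longrightarrow> (u has_vector_derivative u' t) (at t within {0..\<tau>})"
    and growth: "\<And>t. t \<in> {0..\<tau>} \<Longrightarrow> norm (u t) \<le> 1 \<Longrightarrow> norm (u' t) \<le> L * norm (u t)"
    and small: "norm (u 0) * exp (L * \<tau>) < 1" and "0 \<le> L"
    and t: "t \<in> {0..\<tau>}"
  shows "norm (u t) \<le> norm (u 0) * exp (L * t)"
proof -
  have cont: "continuous_on {0..\<tau>} u"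
    using der by (metis continuous_on_eq_continuous_within has_vector_derivative_continuous)
  \<comment> \<open>Conditional on \<open>u\<close> staying in the unit ball before
    \<open>s\<close>; the strict \<open>r < s\<close> allows \<open>s\<close> to be the first time
    the norm reaches 1.\<close>
  have bound: "norm (u s) \<le> norm (u 0) * exp (L * s)"
    if s: "s \<in> {0..\<tau>}" and le1: "\<And>r. 0 < r \<Longrightarrow> r < s \<Longrightarrow> norm (u r) \<le> 1" for s
  proof -
    \<comment> \<open>The weight compensates the growth rate \<open>2 * L\<close> of the squared
      norm, so \<open>g\<close> cannot increase.\<close>
    define g where "g = (\<lambda>r. (u r \<bullet> u r) * exp (- 2 * L * r))"
    have "g s \<le> g 0"
    proof (rule DERIV_nonpos_imp_decreasing_open[where f = g and a = 0 and b = s])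
      show "0 \<le> s" using s by simp
      show "continuous_on {0..s} g"
        unfolding g_def using s by (intro continuous_intros continuous_on_subset[OF cont]) auto
    next
      fix r assume r: "0 < r" "r < s"
      have "(u has_vector_derivative u' r) (at r within {0<..<\<tau>})"
        using der[of r] r s by (auto intro: has_vector_derivative_within_subset)
      then have D: "(u has_vector_derivative u' r) (at r)"
        using r s at_within_open[of r "{0<..<\<tau>}"] by simp
      have "((\<lambda>r. u r \<bullet> u r) has_real_derivative 2 * (u r \<bullet> u' r)) (at r)"
        using has_derivative_inner[OF D[unfolded has_vector_derivative_def] D[unfolded has_vector_derivative_def]]
        by (rule has_derivative_imp_has_field_derivative) (simp add: inner_commute)
      then have "(g has_real_derivative 2 * (u r \<bullet> u' r) * exp (- 2 * L * r)
          + (u r \<bullet> u r) * (exp (- 2 * L * r) * (- 2 * L))) (at r)"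
        unfolding g_def by (auto intro!: derivative_eq_intros)
      moreover have "u r \<bullet> u' r \<le> L * (u r \<bullet> u r)"
      proof -
        have "u r \<bullet> u' r \<le> norm (u r) * norm (u' r)" by (rule norm_cauchy_schwarz)
        also have "\<dots> \<le> norm (u r) * (L * norm (u r))"
          using growth[of r] le1[of r] r s by (intro mult_left_mono) auto
        finally show ?thesis by (simp add: dot_square_norm power2_eq_square mult_ac)
      qed
      then have "2 * (u r \<bullet> u' r) * exp (- 2 * L * r) \<le> 2 * (L * (u r \<bullet> u r)) * exp (- 2 * L * r)"
        by (intro mult_right_mono) auto
      then have "2 * (u r \<bullet> u' r) * exp (- 2 * L * r)
          + (u r \<bullet> u r) * (exp (- 2 * L * r) * (- 2 * L)) \<le> 0"
        by (simp add: algebra_simps)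
      ultimately show "\<exists>y. DERIV g r :> y \<and> y \<le> 0" by blast
    qed
    then have "(norm (u s))\<^sup>2 * exp (- (2 * L * s)) \<le> (norm (u 0))\<^sup>2"
      by (simp add: g_def dot_square_norm)
    then have "(norm (u s))\<^sup>2 * exp (- (2 * L * s)) * exp (2 * L * s) \<le> (norm (u 0))\<^sup>2 * exp (2 * L * s)"
      by (intro mult_right_mono) auto
    moreover have "exp (- (2 * L * s)) * exp (2 * L * s) = 1"
      by (metis exp_minus_inverse mult.commute)
    moreover have "exp (2 * L * s) = (exp (L * s))\<^sup>2"
      by (metis exp_double mult.assoc)
    ultimately have "(norm (u s))\<^sup>2 \<le> (norm (u 0) * exp (L * s))\<^sup>2"
      by (simp only: power_mult_distrib mult.assoc mult_1_right)
    then show ?thesis by (rule power2_le_imp_le) simp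
  qed
  have lt1: "norm (u s) < 1" if s: "s \<in> {0..\<tau>}" for s
  proof (rule ccontr)
    assume "\<not> norm (u s) < 1"
    \<comment> \<open>At the first time in \<open>Z\<close> the estimate \<open>bound\<close> still
      applies, and \<open>small\<close> then puts the norm below 1 there: a contradiction.\<close>
    define Z where "Z = {0..\<tau>} \<inter> (\<lambda>r. norm (u r)) -` {1..}"
    have "Z \<noteq> {}" using s \<open>\<not> norm (u s) < 1\<close> by (auto simp: Z_def)
    moreover have "closed Z" unfolding Z_def
      by (intro continuous_closed_preimage continuous_intros cont)
    moreover have "bdd_below Z" by (auto simp: Z_def)
    ultimately have Inf: "Inf Z \<in> Z" by (blast intro: closed_contains_Inf)
    have "norm (u r) \<le> 1" if "0 < r" "r < Inf Z" for r
    proof -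
      have "r \<notin> Z" using that(2) cInf_lower[OF _ \<open>bdd_below Z\<close>] by (metis not_less)
      with that Inf show ?thesis by (auto simp: Z_def)
    qed
    then have "norm (u (Inf Z)) \<le> norm (u 0) * exp (L * Inf Z)"
      using Inf by (intro bound) (auto simp: Z_def)
    also have "\<dots> \<le> norm (u 0) * exp (L * \<tau>)"
      using Inf \<open>0 \<le> L\<close> by (intro mult_left_mono) (auto simp: Z_def mult_left_mono)
    finally show False using small Inf by (auto simp: Z_def)
  qed
  show ?thesis
    by (rule bound[OF t]) (use lt1 t in \<open>force intro: less_imp_le\<close>)
qed

text \<open>The difference solves the same linear equation with initial value zero, so the smallness
  condition of \<open>gronwall_local\<close> holds trivially.\<close>

lemma linear_vector_ode_unique:
  fixes w y :: "real \<Rightarrow> real^'n" and B :: "real \<Rightarrow> real^'n^'n"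
  assumes w: "\<And>t. t \<in> {0..\<tau>} \<Longrightarrow> (w has_vector_derivative B t *v w t) (at t within {0..\<tau>})"
    and y: "\<And>t. t \<in> {0..\<tau>} \<Longrightarrow> (y has_vector_derivative B t *v y t) (at t within {0..\<tau>})"
    and L: "\<And>t h. t \<in> {0..\<tau>} \<Longrightarrow> norm (B t *v h) \<le> L * norm h"
    and "0 \<le> L" "w 0 = y 0" and t: "t \<in> {0..\<tau>}"
  shows "w t = y t"
proof -
  have "norm (w t - y t) \<le> norm (w 0 - y 0) * exp (L * t)"
  proof (rule gronwall_local[where u = "\<lambda>t. w t - y t" and u' = "\<lambda>t. B t *v (w t - y t)"])
    show "((\<lambda>t. w t - y t) has_vector_derivative B t *v (w t - y t)) (at t within {0..\<tau>})"
      if "t \<in> {0..\<tau>}" for t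
      using has_vector_derivative_diff[OF w y, OF that that]
      by (simp add: matrix_vector_mult_diff_distrib)
  qed (use assms in auto)
  with \<open>w 0 = y 0\<close> show ?thesis by simp
qed

section \<open>The spatial Jacobian of a smooth field\<close>

text \<open>The spatial Jacobian is the joint derivative restricted to directions
  \<open>(h, 0)\<close>, which is how joint smoothness passes to it. Slices at fixed time fill all
  of space, so this derivative is taken at \<open>x\<close> without restriction.\<close>

lemma smooth_on_spatial_derivative:
  fixes f :: "real^'n \<Rightarrow> real \<Rightarrow> real^'m"
  assumes "smooth_on (UNIV \<times> I) (\<lambda>(x, t). f x t)"
  obtains F :: "(real^'n) \<times> real \<Rightarrow> (real^'n) \<times> real \<Rightarrow> real^'m" where
    "\<And>x t. t \<in> I \<Longrightarrow> ((\<lambda>(x, t). f x t) has_derivative F (x, t)) (at (x, t) within UNIV \<times> I)"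
    "\<And>x t h. t \<in> I \<Longrightarrow> F (x, t) (h, 0) = jacobian (\<lambda>y. f y t) (at x) *v h"
    "\<And>h. continuous_on (UNIV \<times> I) (\<lambda>z. F z h)"
    "\<And>x t. t \<in> I \<Longrightarrow>
      ((\<lambda>y. f y t) has_derivative (\<lambda>h. jacobian (\<lambda>y. f y t) (at x) *v h)) (at x)"
proof
  let ?f = "\<lambda>(x, t). f x t" and ?S = "(UNIV :: (real^'n) set) \<times> I"
  define F where "F = (\<lambda>z. frechet_derivative ?f (at z within ?S))"
  from assms have "Ck_on (Suc (Suc 0)) ?S ?f" by (auto simp only: smooth_on_def)
  then have diff: "?f differentiable_on ?S" and C1: "\<And>h. (\<lambda>z. F z h) differentiable_on ?S"
    unfolding F_def Ck_on.simps by blast+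
  show der: "(?f has_derivative F (x, t)) (at (x, t) within ?S)" if "t \<in> I" for x t
    using diff that by (simp add: F_def differentiable_on_def flip: frechet_derivative_works)
  have sp: "((\<lambda>y. f y t) has_derivative (\<lambda>h. F (x, t) (h, 0))) (at x)" if "t \<in> I" for x t
  proof -
    have "((\<lambda>y. (y, t)) has_derivative (\<lambda>h. (h, 0))) (at x within UNIV)"
      by (auto intro!: derivative_eq_intros)
    from has_derivative_in_compose2[OF _ _ UNIV_I this, of ?S ?f F] der that
    show ?thesis by auto
  qed
  show sp': "((\<lambda>y. f y t) has_derivative (\<lambda>h. jacobian (\<lambda>y. f y t) (at x) *v h)) (at x)"
    if "t \<in> I" for x t
    using sp[OF that] jacobian_works differentiable_def by blast
  show "F (x, t) (h, 0) = jacobian (\<lambda>y. f y t) (at x) *v h" if "t \<in> I" for x t h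
    using has_derivative_unique[OF sp sp', OF that that] by metis
  show "continuous_on ?S (\<lambda>z. F z h)" for h
    using C1 by (rule differentiable_imp_continuous_on)
qed

text \<open>Expanding \<open>w s\<close> in the standard basis reduces the claim to the fixed
  directions \<open>(axis i 1, 0)\<close>, where continuity of the joint derivative is
  known.\<close>

lemma continuous_on_spatial_jacobian:
  fixes f :: "real^'n \<Rightarrow> real \<Rightarrow> real^'m"
  assumes "smooth_on (UNIV \<times> I) (\<lambda>(x, t). f x t)"
    and \<gamma>: "continuous_on S \<gamma>" and \<theta>: "continuous_on S \<theta>" and w: "continuous_on S w"
    and I: "\<And>s. s \<in> S \<Longrightarrow> \<theta> s \<in> I"
  shows "continuous_on S (\<lambda>s. jacobian (\<lambda>y. f y (\<theta> s)) (at (\<gamma> s)) *v w s)"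
proof -
  obtain F :: "(real^'n) \<times> real \<Rightarrow> (real^'n) \<times> real \<Rightarrow> real^'m"
    where F: "\<And>x t h. t \<in> I \<Longrightarrow> F (x, t) (h, 0) = jacobian (\<lambda>y. f y t) (at x) *v h"
    and cont: "\<And>h. continuous_on (UNIV \<times> I) (\<lambda>z. F z h)"
    by (rule smooth_on_spatial_derivative[OF assms(1)]) (use that in blast)
  have "continuous_on S (\<lambda>s. \<Sum>i\<in>UNIV. (w s $ i) *\<^sub>R F (\<gamma> s, \<theta> s) (axis i 1, 0))"
    using I by (intro continuous_intros w continuous_on_compose2[OF cont] \<gamma> \<theta>) auto
  then show ?thesis
    by (rule continuous_on_eq)
      (simp add: F[OF I] matrix_mult_sum[of _ "w _"] matrix_vector_mult_basis scalar_mult_eq_scaleR)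
qed

text \<open>Each column is continuous, hence bounded on the compact \<open>K\<close>;
  \<open>L\<close> is the sum of the column bounds.\<close>

lemma spatial_jacobian_bounded:
  fixes f :: "real^'n \<Rightarrow> real \<Rightarrow> real^'m"
  assumes "smooth_on (UNIV \<times> I) (\<lambda>(x, t). f x t)" and "compact K" "K \<subseteq> UNIV \<times> I"
  obtains L where "0 \<le> L"
    "\<And>x t h. (x, t) \<in> K \<Longrightarrow> norm (jacobian (\<lambda>y. f y t) (at x) *v h) \<le> L * norm h"
proof -
  let ?J = "\<lambda>z. jacobian (\<lambda>y. f y (snd z)) (at (fst z))"
  have "\<exists>C. \<forall>z\<in>K. norm (?J z *v axis i 1) \<le> C" for i
  proof -
    have "continuous_on K (\<lambda>z. ?J z *v axis i 1)"
      using assms(3) by (intro continuous_on_spatial_jacobian[OF assms(1)] continuous_intros) auto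
    then have "bounded ((\<lambda>z. ?J z *v axis i 1) ` K)"
      using assms(2) compact_continuous_image compact_imp_bounded by blast
    then show ?thesis by (auto simp: bounded_iff)
  qed
  then obtain C where C: "\<And>i z. z \<in> K \<Longrightarrow> norm (?J z *v axis i 1) \<le> C i" by metis
  show thesis
  proof
    show "0 \<le> (\<Sum>i\<in>UNIV. \<bar>C i\<bar>)" by (simp add: sum_nonneg)
    fix x t and h :: "real^'n" assume z: "(x, t) \<in> K"
    have "?J (x, t) *v h = (\<Sum>i\<in>UNIV. h $ i *\<^sub>R (?J (x, t) *v axis i 1))"
      by (simp add: matrix_mult_sum[of _ h] matrix_vector_mult_basis scalar_mult_eq_scaleR)
    also have "norm \<dots> \<le> (\<Sum>i\<in>UNIV. norm h * \<bar>C i\<bar>)"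
    proof (rule sum_norm_le)
      fix i
      have "norm (?J (x, t) *v axis i 1) \<le> \<bar>C i\<bar>" using C[OF z, of i] by linarith
      then show "norm (h $ i *\<^sub>R (?J (x, t) *v axis i 1)) \<le> norm h * \<bar>C i\<bar>"
        unfolding norm_scaleR
        by (intro mult_mono) (auto simp: component_le_norm_cart)
    qed
    finally show "norm (jacobian (\<lambda>y. f y t) (at x) *v h) \<le> (\<Sum>i\<in>UNIV. \<bar>C i\<bar>) * norm h"
      by (simp add: sum_distrib_left mult.commute)
  qed
qed

section \<open>The variational equation of the flow\<close>

text \<open>
  No joint regularity of \<open>X\<close> in \<open>(a, t)\<close> is available: the difference quotients in the direction
  \<open>h\<close> satisfy an integral equation whose integrand converges pointwise by the chain rule at each
  fixed time, and dominated convergence passes to the limit.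
\<close>

lemma flow_variational_equation:
  fixes v X :: "real^'n \<Rightarrow> real \<Rightarrow> real^'n"
  assumes smooth: "smooth_on (UNIV \<times> I) (\<lambda>(x, t). v x t)" and I: "{0..\<tau>} \<subseteq> I"
    and X0: "\<And>a. X a 0 = a"
    and flow: "\<And>a t. t \<in> {0..\<tau>} \<Longrightarrow> (X a has_vector_derivative v (X a t) t) (at t within {0..\<tau>})"
    and diff: "\<And>t. t \<in> {0..\<tau>} \<Longrightarrow> (\<lambda>a. X a t) differentiable (at a)"
    and t: "t \<in> {0..\<tau>}"
  shows "((\<lambda>t. jacobian (\<lambda>a. X a t) (at a) *v h) has_vector_derivative
      jacobian (\<lambda>y. v y t) (at (X a t)) *v (jacobian (\<lambda>a. X a t) (at a) *v h)) (at t within {0..\<tau>})"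
proof -
  define w where "w = (\<lambda>t. jacobian (\<lambda>a. X a t) (at a) *v h)"
  define J where "J = (\<lambda>t. jacobian (\<lambda>y. v y t) (at (X a t)))"
  have contX: "continuous_on {0..\<tau>} (X a)" for a
    using flow by (metis continuous_on_eq_continuous_within has_vector_derivative_continuous)
  have tau0: "0 \<le> \<tau>" using t by simp
  have "bounded (X a ` {0..\<tau>})"
    by (intro compact_imp_bounded compact_continuous_image contX compact_Icc)
  then obtain R where R: "\<And>t. t \<in> {0..\<tau>} \<Longrightarrow> norm (X a t) \<le> R"
    unfolding bounded_iff by blast
  \<comment> \<open>The radius \<open>R + 1\<close> covers all trajectories within distance 1 of
    \<open>X a\<close>, the range in which \<open>gronwall_local\<close> asks for the growth
    condition.\<close>
  obtain L where "0 \<le> L" and L: "\<And>x t h. norm x \<le> R + 1 \<Longrightarrow> t \<in> {0..\<tau>} \<Longrightarrow>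
      norm (jacobian (\<lambda>y. v y t) (at x) *v h) \<le> L * norm h"
  proof (rule spatial_jacobian_bounded[OF smooth])
    show "compact (cball 0 (R + 1) \<times> {0..\<tau>} :: ((real^'n) \<times> real) set)"
      by (intro compact_Times) auto
  qed (use I in auto)
  have vder: "((\<lambda>y. v y t) has_derivative (\<lambda>h. jacobian (\<lambda>y. v y t) (at x) *v h)) (at x)"
    if "t \<in> {0..\<tau>}" for x t
    using smooth_on_spatial_derivative[OF smooth] that I by (metis subsetD)
  have lip: "norm (v x t - v y t) \<le> L * norm (x - y)"
    if "norm x \<le> R + 1" "norm y \<le> R + 1" "t \<in> {0..\<tau>}" for x y t
  proof (rule differentiable_bound[where S = "cball 0 (R + 1)"])
    show "((\<lambda>y. v y t) has_derivative (\<lambda>h. jacobian (\<lambda>y. v y t) (at x) *v h))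
        (at x within cball 0 (R + 1))" for x
      using vder[OF that(3)] by (rule has_derivative_at_withinI)
    show "onorm (\<lambda>h. jacobian (\<lambda>y. v y t) (at x) *v h) \<le> L" if "x \<in> cball 0 (R + 1)" for x
      using that L \<open>t \<in> {0..\<tau>}\<close> \<open>0 \<le> L\<close> by (intro onorm_bound) auto
  qed (use that in auto)
  \<comment> \<open>Chosen so that each initial displacement \<open>s n *\<^sub>R h\<close>
    satisfies the smallness condition up to time \<open>\<tau>\<close>; the summand 1 makes the
    inequality strict and covers \<open>h = 0\<close>.\<close>
  define \<epsilon> where "\<epsilon> = inverse (norm h * exp (L * \<tau>) + 1)"
  have "0 < norm h * exp (L * \<tau>) + 1" by (rule add_nonneg_pos) auto
  then have eps: "0 < \<epsilon>" "\<epsilon> * (norm h * exp (L * \<tau>)) < 1"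
    by (auto simp: \<epsilon>_def inverse_eq_divide pos_divide_less_eq)
  define s where "s = (\<lambda>n. \<epsilon> / real (Suc n))"
  have s: "0 < s n" "s n \<le> \<epsilon>" for n
    using eps(1) by (simp_all add: s_def pos_divide_le_eq)
  have s_lim: "s \<longlonglongrightarrow> 0"
    unfolding s_def by (rule LIMSEQ_Suc[OF lim_const_over_n])
  define u where "u = (\<lambda>n t. X (a + s n *\<^sub>R h) t - X a t)"
  define G where "G = (\<lambda>n t. (v (X (a + s n *\<^sub>R h) t) t - v (X a t) t) /\<^sub>R s n)"
  have uder: "(u n has_vector_derivative s n *\<^sub>R G n t) (at t within {0..\<tau>})"
    if "t \<in> {0..\<tau>}" for n t
    using has_vector_derivative_diff[OF flow flow, OF that that] s(1)[of n]
    by (simp add: u_def G_def)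
  have ubound: "norm (u n t) \<le> s n * norm h * exp (L * t) \<and> norm (u n t) \<le> 1"
    if t: "t \<in> {0..\<tau>}" for n t
  proof -
    have u0: "norm (u n 0) = s n * norm h" using s(1)[of n] by (simp add: u_def X0)
    have small: "s n * norm h * exp (L * \<tau>) < 1"
    proof -
      have "s n * (norm h * exp (L * \<tau>)) \<le> \<epsilon> * (norm h * exp (L * \<tau>))"
        using s(2) by (intro mult_right_mono) auto
      with eps(2) show ?thesis by (simp add: mult.assoc)
    qed
    have "norm (u n t) \<le> norm (u n 0) * exp (L * t)"
    proof (rule gronwall_local[OF uder _ _ \<open>0 \<le> L\<close> t])
      fix t assume t: "t \<in> {0..\<tau>}" and le: "norm (u n t) \<le> 1"
      have "norm (X (a + s n *\<^sub>R h) t) \<le> R + 1"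
        using R[OF t] le norm_triangle_sub[of "X (a + s n *\<^sub>R h) t" "X a t"] by (simp add: u_def)
      then show "norm (s n *\<^sub>R G n t) \<le> L * norm (u n t)"
        using lip[of "X (a + s n *\<^sub>R h) t" "X a t" t] R[OF t] t s(1)[of n]
        by (simp add: G_def u_def)
    qed (use small u0 in auto)
    moreover have "s n * norm h * exp (L * t) \<le> s n * norm h * exp (L * \<tau>)"
      using t s(1)[of n] \<open>0 \<le> L\<close> by (intro mult_left_mono) (auto simp: mult_left_mono)
    ultimately show ?thesis using u0 small by auto
  qed
  \<comment> \<open>Uniform in \<open>n\<close> and \<open>t\<close>, because the factor
    \<open>s n\<close> in \<open>ubound\<close> cancels the division in \<open>G\<close>; this is
    the dominating constant below.\<close>
  have Gbound: "norm (G n t) \<le> L * norm h * exp (L * \<tau>)" if t: "t \<in> {0..\<tau>}" for n t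
  proof -
    have "norm (X (a + s n *\<^sub>R h) t) \<le> R + 1"
      using R[OF t] ubound[OF t, of n] norm_triangle_sub[of "X (a + s n *\<^sub>R h) t" "X a t"]
      by (simp add: u_def)
    then have "norm (G n t) \<le> L * norm (u n t) / s n"
      using lip[of "X (a + s n *\<^sub>R h) t" "X a t" t] R[OF t] t s(1)[of n]
      by (simp add: G_def u_def divide_inverse_commute)
    also have "\<dots> \<le> L * (s n * norm h * exp (L * t)) / s n"
      using ubound[OF t, of n] s(1)[of n] \<open>0 \<le> L\<close>
      by (intro divide_right_mono mult_left_mono) auto
    also have "\<dots> = L * norm h * exp (L * t)" using s(1)[of n] by simp
    also have "\<dots> \<le> L * norm h * exp (L * \<tau>)"
      using t \<open>0 \<le> L\<close> by (intro mult_left_mono) (auto simp: mult_left_mono)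
    finally show ?thesis .
  qed
  \<comment> \<open>Applied to the flow map this gives the limit of
    \<open>u n t /\<^sub>R s n\<close>, and to the velocity composed with it the limit of
    \<open>G n t\<close>.\<close>
  have quot: "(\<lambda>n. (f (a + s n *\<^sub>R h) - f a) /\<^sub>R s n) \<longlonglongrightarrow> f' h"
    if f: "(f has_derivative f') (at a)" for f f' :: "real^'n \<Rightarrow> real^'n"
  proof -
    have "((\<lambda>r. a + r *\<^sub>R h) has_derivative (\<lambda>r. r *\<^sub>R h)) (at 0)"
      by (auto intro!: derivative_eq_intros)
    then have "((\<lambda>r. f (a + r *\<^sub>R h)) has_derivative (\<lambda>r. f' (r *\<^sub>R h))) (at 0)"
      using has_derivative_compose[of "\<lambda>r. a + r *\<^sub>R h" _ 0 UNIV f f'] f by simp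
    then have "((\<lambda>r. (f (a + r *\<^sub>R h) - f a - f' (r *\<^sub>R h)) /\<^sub>R norm r) \<longlongrightarrow> 0) (at 0)"
      unfolding has_derivative_within by (simp add: diff_diff_eq inverse_eq_divide)
    moreover have "filterlim s (at 0) sequentially"
    proof (rule filterlim_atI[OF s_lim])
      show "\<forall>\<^sub>F n in sequentially. s n \<noteq> 0"
        using s(1) by (intro always_eventually) (metis less_irrefl)
    qed
    ultimately have "(\<lambda>n. (f (a + s n *\<^sub>R h) - f a - f' (s n *\<^sub>R h)) /\<^sub>R norm (s n)) \<longlonglongrightarrow> 0"
      by (rule filterlim_compose)
    moreover have "(f (a + s n *\<^sub>R h) - f a - f' (s n *\<^sub>R h)) /\<^sub>R norm (s n)
        = (f (a + s n *\<^sub>R h) - f a) /\<^sub>R s n - f' h" for n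
      using s(1)[of n] linear_cmul[OF has_derivative_linear[OF f], of "s n" h]
      by (simp add: scaleR_diff_right)
    ultimately show ?thesis by (simp add: LIM_zero_iff)
  qed
  have Xder: "((\<lambda>a. X a t) has_derivative (\<lambda>h. jacobian (\<lambda>a. X a t) (at a) *v h)) (at a)"
    if "t \<in> {0..\<tau>}" for t
    using diff[OF that] jacobian_works by blast
  have ulim: "(\<lambda>n. u n t /\<^sub>R s n) \<longlonglongrightarrow> w t" if "t \<in> {0..\<tau>}" for t
    using quot[OF Xder[OF that]] by (simp add: u_def w_def)
  have Glim: "(\<lambda>n. G n t) \<longlonglongrightarrow> J t *v w t" if "t \<in> {0..\<tau>}" for t
    using quot[OF has_derivative_compose[OF Xder vder, OF that that]] by (simp add: G_def w_def J_def)
  \<comment> \<open>The term \<open>h\<close> is the initial value of the quotient, since the flow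
    starts at the identity.\<close>
  have Gint: "(G n has_integral (u n t /\<^sub>R s n - h)) {0..t}" if t: "t \<in> {0..\<tau>}" for n t
  proof -
    have "((\<lambda>t. u n t /\<^sub>R s n) has_vector_derivative G n r) (at r within {0..t})" if "r \<in> {0..t}" for r
    proof -
      have "(u n has_vector_derivative s n *\<^sub>R G n r) (at r within {0..t})"
        using uder[of r n] that t by (auto intro: has_vector_derivative_within_subset)
      then have "((\<lambda>t. inverse (s n) *\<^sub>R u n t) has_vector_derivative inverse (s n) *\<^sub>R (s n *\<^sub>R G n r))
          (at r within {0..t})"
        by (auto intro!: derivative_eq_intros)
      then show ?thesis using s(1)[of n] by simp
    qed
    from fundamental_theorem_of_calculus[OF _ this] t s(1)[of n] show ?thesis
      by (simp add: u_def X0)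
  qed
  have dct: "(\<lambda>t. J t *v w t) integrable_on {0..t}"
      "(\<lambda>n. integral {0..t} (G n)) \<longlonglongrightarrow> integral {0..t} (\<lambda>t. J t *v w t)"
    if t: "t \<in> {0..\<tau>}" for t
  proof -
    show "(\<lambda>t. J t *v w t) integrable_on {0..t}"
      "(\<lambda>n. integral {0..t} (G n)) \<longlonglongrightarrow> integral {0..t} (\<lambda>t. J t *v w t)"
      using t
      by (auto intro!: dominated_convergence[where h = "\<lambda>_. L * norm h * exp (L * \<tau>)" and f = G]
          Gbound Glim has_integral_integrable[OF Gint])
  qed
  have w_eq: "w t = h + integral {0..t} (\<lambda>t. J t *v w t)" if t: "t \<in> {0..\<tau>}" for t
  proof -
    have "(\<lambda>n. integral {0..t} (G n)) \<longlonglongrightarrow> w t - h"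
      using tendsto_diff[OF ulim[OF t] tendsto_const[of h]] by (simp only: integral_unique[OF Gint[OF t]])
    from LIMSEQ_unique[OF this dct(2)[OF t]] show ?thesis by (simp add: algebra_simps)
  qed
  \<comment> \<open>Bootstrap: an indefinite integral is continuous, so \<open>w\<close> is; then
    the integrand is continuous and the integral equation can be differentiated.\<close>
  have "continuous_on {0..\<tau>} (\<lambda>t. h + integral {0..t} (\<lambda>t. J t *v w t))"
    using dct(1)[of \<tau>] tau0 by (intro continuous_intros indefinite_integral_continuous_1) auto
  then have "continuous_on {0..\<tau>} w"
    by (rule continuous_on_eq) (use w_eq in auto)
  then have "continuous_on {0..\<tau>} (\<lambda>t. J t *v w t)"
    unfolding J_def using I
    by (intro continuous_on_spatial_jacobian[OF smooth] contX) (auto intro: continuous_intros)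
  from integral_has_vector_derivative[OF this t]
  have "((\<lambda>t. h + integral {0..t} (\<lambda>t. J t *v w t)) has_vector_derivative J t *v w t)
      (at t within {0..\<tau>})"
    by (auto intro!: derivative_eq_intros)
  then have "(w has_vector_derivative J t *v w t) (at t within {0..\<tau>})"
    by (rule has_vector_derivative_transform[OF t, rotated]) (use w_eq in auto)
  then show ?thesis by (simp add: w_def J_def)
qed

text \<open>Liouville's formula: the derivative of \<open>det (W t)\<close> is the trace of
  \<open>B t\<close> times \<open>det (W t)\<close>, hence zero.\<close>

lemma linear_flow_det_constant:
  fixes W B :: "real \<Rightarrow> real^3^3"
  assumes W: "\<And>t h. t \<in> {0..\<tau>} \<Longrightarrow>
      ((\<lambda>t. W t *v h) has_vector_derivative B t *v (W t *v h)) (at t within {0..\<tau>})"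
    and trace: "\<And>t. t \<in> {0..\<tau>} \<Longrightarrow> (\<Sum>i\<in>UNIV. B t $ i $ i) = 0"
    and t: "t \<in> {0..\<tau>}"
  shows "det (W t) = det (W 0)"
proof -
  have entry: "((\<lambda>t. W t $ i $ j) has_real_derivative (B t ** W t) $ i $ j) (at t within {0..\<tau>})"
    if "t \<in> {0..\<tau>}" for t i j
  proof -
    have "((\<lambda>t. (W t *v axis j 1) $ i) has_vector_derivative (B t *v (W t *v axis j 1)) $ i)
        (at t within {0..\<tau>})"
      using W[OF that]
      by (rule bounded_linear.has_vector_derivative[OF bounded_linear_vec_nth])
    then show ?thesis
      unfolding matrix_vector_mul_assoc unfolding matrix_vector_mult_basis column_def
      by (simp add: has_real_derivative_iff_has_vector_derivative)
  qed
  have "((\<lambda>t. det (W t)) has_real_derivative 0) (at t within {0..\<tau>})" if t: "t \<in> {0..\<tau>}" for t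
  proof -
    \<comment> \<open>Eliminating one diagonal entry leaves a polynomial identity for the
      differentiated expansion of the determinant.\<close>
    have B33: "B t $ 3 $ 3 = - B t $ 1 $ 1 - B t $ 2 $ 2"
      using trace[OF t] by (simp add: sum_3)
    have prod: "(B t ** W t) $ i $ j = (\<Sum>k\<in>UNIV. B t $ i $ k * W t $ k $ j)" for i j
      by (simp add: matrix_matrix_mult_def)
    show ?thesis
      unfolding det_3
      by (rule entry[OF t] derivative_eq_intros refl)+
        (simp only: prod sum_3 B33, simp add: algebra_simps)
  qed
  then obtain c where "\<And>s. s \<in> {0..\<tau>} \<Longrightarrow> det (W s) = c"
    using has_field_derivative_zero_constant[of "{0..\<tau>}" "\<lambda>t. det (W t)"] convex_real_interval
    by blast
  with t show ?thesis by auto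
qed

section \<open>Eigenframes\<close>

lemma ordered_eigenframe_orthogonal_matrix:
  assumes "ordered_eigenframe M lam e"
  shows "orthogonal_matrix (\<chi> i j. e j $ i)"
proof -
  have "column j (\<chi> i j. e j $ i) = e j" for j
    by (simp add: column_def vec_eq_iff)
  then show ?thesis
    using assms
    by (simp add: orthogonal_matrix_orthonormal_columns ordered_eigenframe_def
        orthogonal_def norm_eq_1)
qed

text \<open>With the eigenvectors as columns of \<open>P\<close> and \<open>D\<close> diagonal,
  \<open>M ** P = P ** D\<close>, and the nonzero \<open>det P\<close> cancels.\<close>

lemma ordered_eigenframe_det:
  assumes "ordered_eigenframe M lam e"
  shows "det M = lam 1 * lam 2 * lam 3"
proof -
  define P :: "real^3^3" where "P = (\<chi> i j. e j $ i)"
  define D :: "real^3^3" where "D = (\<chi> i j. if i = j then lam j else 0)"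
  have "orthogonal_matrix P"
    unfolding P_def by (rule ordered_eigenframe_orthogonal_matrix[OF assms])
  then have "det P \<noteq> 0" using det_orthogonal_matrix by fastforce
  moreover have "M ** P = P ** D"
  proof -
    have "M *v e j = lam j *\<^sub>R e j" for j using assms by (simp add: ordered_eigenframe_def)
    then show ?thesis
      by (simp add: vec_eq_iff matrix_matrix_mult_def matrix_vector_mult_def P_def D_def
          if_distrib mult.commute cong: if_cong)
  qed
  then have "det M * det P = det P * det D" by (metis det_mul)
  moreover have "det D = lam 1 * lam 2 * lam 3"
    by (simp add: det_3 D_def)
  ultimately show ?thesis by simp
qed

text \<open>This is \<open>P ** transpose P = mat 1\<close> applied to \<open>x\<close>, for the
  orthogonal matrix \<open>P\<close> with columns \<open>e j\<close>.\<close>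

lemma ordered_eigenframe_expansion:
  assumes "ordered_eigenframe M lam e"
  shows "x = (\<Sum>j\<in>UNIV. (e j \<bullet> x) *\<^sub>R e j)"
proof -
  define P :: "real^3^3" where "P = (\<chi> i j. e j $ i)"
  have col: "column j P = e j" for j
    by (simp add: P_def column_def vec_eq_iff)
  have "orthogonal_matrix P"
    unfolding P_def by (rule ordered_eigenframe_orthogonal_matrix[OF assms])
  then have "x = P *v (transpose P *v x)"
    by (metis matrix_vector_mul_assoc matrix_vector_mul_lid orthogonal_matrix_def)
  also have "\<dots> = (\<Sum>j\<in>UNIV. (e j \<bullet> x) *\<^sub>R e j)"
    by (simp add: matrix_mult_sum[of P] col scalar_mult_eq_scaleR)
      (simp add: P_def vector_matrix_mult_def inner_vec_def mult.commute)
  finally show ?thesis .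
qed

lemma ordered_eigenframe_quadratic:
  assumes "ordered_eigenframe M lam e"
  shows "x \<bullet> (M *v x) = (\<Sum>j\<in>UNIV. lam j * (e j \<bullet> x)\<^sup>2)"
    and "x \<bullet> x = (\<Sum>j\<in>UNIV. (e j \<bullet> x)\<^sup>2)"
proof -
  have eig: "M *v e j = lam j *\<^sub>R e j" for j using assms by (simp add: ordered_eigenframe_def)
  have "M *v x = M *v (\<Sum>j\<in>UNIV. (e j \<bullet> x) *\<^sub>R e j)"
    using ordered_eigenframe_expansion[OF assms, of x] by simp
  also have "\<dots> = (\<Sum>j\<in>UNIV. (e j \<bullet> x) *\<^sub>R (lam j *\<^sub>R e j))"
    by (simp add: linear_sum linear_cmul eig)
  finally have "x \<bullet> (M *v x) = x \<bullet> (\<Sum>j\<in>UNIV. (e j \<bullet> x) *\<^sub>R (lam j *\<^sub>R e j))" by simp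
  then show "x \<bullet> (M *v x) = (\<Sum>j\<in>UNIV. lam j * (e j \<bullet> x)\<^sup>2)"
    by (simp add: inner_sum_right inner_commute power2_eq_square mult_ac)
  have "x \<bullet> x = x \<bullet> (\<Sum>j\<in>UNIV. (e j \<bullet> x) *\<^sub>R e j)"
    using ordered_eigenframe_expansion[OF assms, of x] by simp
  then show "x \<bullet> x = (\<Sum>j\<in>UNIV. (e j \<bullet> x)\<^sup>2)"
    by (simp add: inner_sum_right inner_commute power2_eq_square)
qed

section \<open>From an essential bound to a pointwise bound\<close>

lemma continuous_esssup_bound:
  fixes f :: "'a::euclidean_space \<Rightarrow> 'b::real_normed_vector"
  assumes cont: "continuous_on UNIV f" and fin: "esssup lborel (\<lambda>x. ereal (norm (f x))) < \<infinity>"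
  obtains C where "0 < C" "\<And>x. norm (f x) \<le> C"
proof -
  let ?s = "esssup lborel (\<lambda>x. ereal (norm (f x)))"
  \<comment> \<open>\<open>U\<close> is open by continuity and null by the property of the essential
    supremum, hence empty.\<close>
  define U where "U = {x. ?s < ereal (norm (f x))}"
  have "open U"
    unfolding U_def by (intro open_Collect_less continuous_intros cont)
  moreover have "emeasure lborel U = 0"
    using esssup_zero_measure[of lborel "\<lambda>x. ereal (norm (f x))"] by (simp add: U_def)
  then have "negligible U"
    using \<open>open U\<close> by (auto simp: negligible_iff_null_sets intro!: null_sets_completionI null_setsI)
  ultimately have "U = {}" using open_not_negligible by blast
  then have le: "ereal (norm (f x)) \<le> ?s" for x by (auto simp: U_def not_less)
  from le[of 0] fin obtain r where r: "?s = ereal r" by (cases ?s) auto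
  \<comment> \<open>The maximum makes the bound positive even for the zero field; the lower bound on
    the largest eigenvalue divides by it.\<close>
  show thesis
  proof (rule that[of "max r 1"])
    show "norm (f x) \<le> max r 1" for x using le[of x] by (simp add: r)
  qed simp
qed

section \<open>Transport by the flow\<close>

lemma time_interval_Icc: "t \<in> time_interval T \<Longrightarrow> {0..t} \<subseteq> time_interval T"
  by (auto simp: time_interval_def intro: le_less_trans[of "ereal _" "ereal t"])

text \<open>As \<open>T\<close> is excluded, there is room to the right of \<open>t\<close>, also at
  \<open>t = 0\<close>; this makes the derivative within the interval unique.\<close>

lemma at_within_time_interval_neq_bot:
  assumes "t \<in> time_interval T"
  shows "at t within time_interval T \<noteq> bot"
proof -
  from assms have "0 \<le> t" "ereal t < T" by (auto simp: time_interval_def)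
  then obtain s where s: "t < s" "ereal s < T"
    using ereal_dense2[of "ereal t" T] by auto
  then have "{0..s} \<subseteq> time_interval T"
    using \<open>0 \<le> t\<close> by (intro time_interval_Icc) (auto simp: time_interval_def)
  moreover have "t islimpt {0..s}"
    using s \<open>0 \<le> t\<close> islimpt_Icc[of 0 s t] by auto
  ultimately show ?thesis
    using islimpt_subset trivial_limit_within by blast
qed

lemma convective_eq_jacobian: "convective u f x = jacobian f (at x) *v u x"
  by (simp add: convective_def matrix_vector_mult_def vec_eq_iff mult.commute)

text \<open>The material derivative: the joint derivative in the direction \<open>(v, 1)\<close>
  splits into \<open>(0, 1)\<close> and \<open>(v, 0)\<close>.\<close>

lemma has_vector_derivative_along_trajectory:
  assumes smooth: "smooth_on (UNIV \<times> time_interval T) (\<lambda>(x, t). f x t)"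
    and X: "particle_trajectory_map T v X" and t: "t \<in> time_interval T"
  shows "((\<lambda>t. f (X a t) t) has_vector_derivative
      time_deriv T f (X a t) t + convective (\<lambda>y. v y t) (\<lambda>y. f y t) (X a t))
      (at t within time_interval T)"
proof -
  let ?I = "time_interval T" and ?x = "X a t"
  obtain F :: "(real^3) \<times> real \<Rightarrow> (real^3) \<times> real \<Rightarrow> real^3" where
    der: "\<And>x t. t \<in> ?I \<Longrightarrow> ((\<lambda>(x, t). f x t) has_derivative F (x, t)) (at (x, t) within UNIV \<times> ?I)"
    and sp: "\<And>x t h. t \<in> ?I \<Longrightarrow> F (x, t) (h, 0) = jacobian (\<lambda>y. f y t) (at x) *v h"
    using smooth_on_spatial_derivative[OF smooth] by metis
  have lin: "linear (F (?x, t))" using der[OF t] by (rule has_derivative_linear)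
  \<comment> \<open>Used for the constant curve, to identify \<open>time_deriv\<close>, and for the
    trajectory itself.\<close>
  have curve: "((\<lambda>s. f (\<gamma> s) s) has_vector_derivative F (?x, t) (d, 1)) (at t within ?I)"
    if \<gamma>: "(\<gamma> has_vector_derivative d) (at t within ?I)" and "\<gamma> t = ?x" for \<gamma> d
  proof -
    have pair: "((\<lambda>s. (\<gamma> s, s)) has_derivative (\<lambda>r. (r *\<^sub>R d, r))) (at t within ?I)"
      using \<gamma> unfolding has_vector_derivative_def
      by (auto intro!: derivative_eq_intros)
    have "((\<lambda>s. (\<lambda>(x, t). f x t) (\<gamma> s, s)) has_derivative (\<lambda>r. F (\<gamma> t, t) (r *\<^sub>R d, r)))
        (at t within ?I)"
      by (rule has_derivative_in_compose2[where t = "UNIV \<times> ?I" and g' = F, OF _ _ t pair])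
        (use der in auto)
    moreover have "F (?x, t) (r *\<^sub>R d, r) = r *\<^sub>R F (?x, t) (d, 1)" for r
      using linear_cmul[OF lin, of r "(d, 1)"] by simp
    ultimately show ?thesis by (simp add: has_vector_derivative_def \<open>\<gamma> t = ?x\<close>)
  qed
  have "time_deriv T f ?x t = F (?x, t) (0, 1)"
    unfolding time_deriv_def
    by (rule vector_derivative_within[OF at_within_time_interval_neq_bot[OF t]])
      (use curve[of "\<lambda>_. ?x" 0] in simp)
  moreover have "convective (\<lambda>y. v y t) (\<lambda>y. f y t) ?x = F (?x, t) (v ?x t, 0)"
    by (simp add: convective_eq_jacobian sp[OF t])
  moreover have "F (?x, t) (v ?x t, 1) = F (?x, t) (0, 1) + F (?x, t) (v ?x t, 0)"
    using linear_add[OF lin, of "(0, 1)" "(v ?x t, 0)"] by simp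
  moreover have "(X a has_vector_derivative v ?x t) (at t within ?I)"
    using X t by (simp add: particle_trajectory_map_def)
  ultimately show ?thesis using curve[of "X a" "v ?x t"] by simp
qed

lemma diffeomorphism_differentiable:
  assumes "diffeomorphism f"
  shows "f differentiable (at x)" "inv f differentiable (at x)"
proof -
  have "Ck_on (Suc 0) UNIV f" "Ck_on (Suc 0) UNIV (inv f)"
    using assms by (auto simp only: diffeomorphism_def smooth_on_def)
  then show "f differentiable (at x)" "inv f differentiable (at x)"
    by (auto simp: differentiable_on_def)
qed

text \<open>Both claims invert facts about the forward flow with Jacobian \<open>W\<close>: Cauchy's
  formula \<open>W t *v b0 a = b x t\<close> and volume conservation
  \<open>det (W t) = 1\<close>.\<close>

lemma label_map_transport:
  assumes sol: "smooth_ideal_mhd_solution T v0 b0 v b p"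
    and X: "particle_trajectory_map T v X"
    and diffeo: "\<And>t. t \<in> time_interval T \<Longrightarrow> diffeomorphism (\<lambda>a. X a t)"
    and t: "t \<in> time_interval T"
  shows "jacobian (\<lambda>y. back_to_label_map X y t) (at x) *v b x t = b0 (back_to_label_map X x t)"
    and "det (jacobian (\<lambda>y. back_to_label_map X y t) (at x)) = 1"
proof -
  let ?I = "time_interval T"
  have sub: "{0..t} \<subseteq> ?I" using t by (rule time_interval_Icc)
  have t0: "t \<in> {0..t}" using t by (simp add: time_interval_def)
  have smv: "smooth_on (UNIV \<times> ?I) (\<lambda>(x, t). v x t)"
    and smb: "smooth_on (UNIV \<times> ?I) (\<lambda>(x, t). b x t)"
    using sol by (simp_all add: smooth_ideal_mhd_solution_def)
  have X0: "X a 0 = a" for a using X by (simp add: particle_trajectory_map_def)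
  have flow: "(X a has_vector_derivative v (X a s) s) (at s within {0..t})" if "s \<in> {0..t}" for a s
    using X that sub unfolding particle_trajectory_map_def
    by (meson has_vector_derivative_within_subset subsetD)
  have diff: "(\<lambda>a. X a s) differentiable (at a)" if "s \<in> {0..t}" for a s
    using diffeomorphism_differentiable(1)[OF diffeo] that sub by blast
  define a where "a = back_to_label_map X x t"
  have bij: "bij (\<lambda>a. X a t)" using diffeo[OF t] by (simp add: diffeomorphism_def)
  then have Xa: "X a t = x"
    by (simp add: a_def back_to_label_map_def bij_is_surj surj_f_inv_f[of "\<lambda>a. X a t"])
  define W where "W = (\<lambda>s. jacobian (\<lambda>a. X a s) (at a))"
  define B where "B = (\<lambda>s. jacobian (\<lambda>y. v y s) (at (X a s)))"
  have var: "((\<lambda>s. W s *v h) has_vector_derivative B s *v (W s *v h)) (at s within {0..t})"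
    if "s \<in> {0..t}" for s h
    unfolding W_def B_def using flow_variational_equation[OF smv sub X0 flow diff that] .
  have "W 0 = mat 1"
    by (simp add: W_def X0 jacobian_def frechet_derivative_ident matrix_id_mat_1[unfolded id_def])
  have "det (W t) = det (W 0)"
  proof (rule linear_flow_det_constant[OF var _ t0])
    show "(\<Sum>i\<in>UNIV. B s $ i $ i) = 0" if "s \<in> {0..t}" for s
      using sol that sub unfolding smooth_ideal_mhd_solution_def divergence_def B_def by blast
  qed
  then have detW: "det (W t) = 1" by (simp add: \<open>W 0 = mat 1\<close>)
  \<comment> \<open>The induction equation makes \<open>b\<close> along the trajectory solve the
    same linear equation as \<open>W s *v b0 a\<close>.\<close>
  have bder: "((\<lambda>s. b (X a s) s) has_vector_derivative B s *v b (X a s) s) (at s within {0..t})"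
    if s: "s \<in> {0..t}" for s
  proof -
    have "s \<in> ?I" using s sub by blast
    then have "time_deriv T b (X a s) s + convective (\<lambda>y. v y s) (\<lambda>y. b y s) (X a s)
        = B s *v b (X a s) s"
      using sol by (simp add: smooth_ideal_mhd_solution_def convective_eq_jacobian B_def)
    with has_vector_derivative_along_trajectory[OF smb X \<open>s \<in> ?I\<close>, of a]
    show ?thesis using sub has_vector_derivative_within_subset by fastforce
  qed
  have "continuous_on {0..t} (X a)"
    using flow by (metis continuous_on_eq_continuous_within has_vector_derivative_continuous)
  \<comment> \<open>Compactness of the space-time path bounds the velocity Jacobian along it, as
    uniqueness requires.\<close>
  then have "compact ((\<lambda>s. (X a s, s)) ` {0..t})"
    by (intro compact_continuous_image continuous_intros) auto
  then obtain L where "0 \<le> L" and L: "\<And>y s h. (y, s) \<in> (\<lambda>s. (X a s, s)) ` {0..t} \<Longrightarrow>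
      norm (jacobian (\<lambda>y. v y s) (at y) *v h) \<le> L * norm h"
    by (rule spatial_jacobian_bounded[OF smv]) (use sub in auto)
  have "W t *v b0 a = b (X a t) t"
  proof (rule linear_vector_ode_unique[OF var bder _ \<open>0 \<le> L\<close> _ t0])
    show "norm (B s *v h) \<le> L * norm h" if "s \<in> {0..t}" for s h
      unfolding B_def by (rule L) (use that in auto)
    show "W 0 *v b0 a = b (X a 0) 0"
      using sol by (simp add: \<open>W 0 = mat 1\<close> X0 smooth_ideal_mhd_solution_def)
  qed
  then have Wb: "W t *v b0 a = b x t" by (simp add: Xa)
  let ?J = "jacobian (\<lambda>y. back_to_label_map X y t) (at x)"
  \<comment> \<open>Chain rule for the back-to-label map after \<open>X\<close> at fixed time, which
    is the identity.\<close>
  have "?J ** W t = mat 1"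
  proof -
    have "((\<lambda>a. X a t) has_derivative (\<lambda>h. W t *v h)) (at a)"
      using diff[OF t0, of a] by (simp add: W_def flip: jacobian_works)
    moreover have "(\<lambda>y. back_to_label_map X y t) differentiable (at x)"
      using diffeomorphism_differentiable(2)[OF diffeo[OF t], of x]
      by (simp add: back_to_label_map_def)
    then have "((\<lambda>y. back_to_label_map X y t) has_derivative (\<lambda>h. ?J *v h)) (at (X a t))"
      by (simp add: Xa flip: jacobian_works)
    ultimately have "((\<lambda>a. back_to_label_map X (X a t) t) has_derivative (\<lambda>h. ?J *v (W t *v h))) (at a)"
      by (rule has_derivative_compose)
    moreover have "back_to_label_map X (X a t) t = a" for a
      using bij by (simp add: back_to_label_map_def inv_f_f[of "\<lambda>a. X a t"] bij_is_inj)
    ultimately have "(\<lambda>h. ?J *v (W t *v h)) = (\<lambda>h. h)"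
      using has_derivative_unique[OF _ has_derivative_ident] by simp
    then have "(?J ** W t) *v h = mat 1 *v h" for h
      by (simp add: matrix_vector_mul_assoc fun_eq_iff)
    then show ?thesis by (simp add: matrix_eq)
  qed
  then show "?J *v b x t = b0 (back_to_label_map X x t)" "det ?J = 1"
    by (auto simp flip: Wb a_def simp: matrix_vector_mul_assoc)
      (metis det_I det_mul detW mult.right_neutral)
qed

section \<open>Blow-up of the magnetic field\<close>

text \<open>The squared norm of the Jacobian applied to \<open>b\<close> is a sum of nonnegative
  eigenframe terms, so \<open>C\<^sup>2\<close> bounds each of them; determinant 1 ties the
  eigenvalues together.\<close>

lemma label_gram_matrix_bounds:
  assumes frame: "ordered_eigenframe (label_gram_matrix A x t) lam e"
    and det: "det (jacobian (\<lambda>y. A y t) (at x)) = 1"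
    and le: "norm (jacobian (\<lambda>y. A y t) (at x) *v b) \<le> C" and "b \<noteq> 0"
  shows "lam 3 \<le> (C / norm b)\<^sup>2" "1 \<le> lam 1 ^ 2 * lam 3"
    "\<bar>(b /\<^sub>R norm b) \<bullet> e 1\<bar> \<le> C / norm b"
    "lam 2 * ((b /\<^sub>R norm b) \<bullet> e 2)\<^sup>2 \<le> (C / norm b)\<^sup>2"
proof -
  let ?J = "jacobian (\<lambda>y. A y t) (at x)"
  define c where "c j = e j \<bullet> b" for j
  have ord: "lam 1 \<ge> lam 2" "lam 2 \<ge> lam 3" "lam 3 > 0"
    using frame by (auto simp: ordered_eigenframe_def)
  have "b \<bullet> (label_gram_matrix A x t *v b) = (norm (?J *v b))\<^sup>2"
    unfolding label_gram_matrix_def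
    by (metis dot_lmul_matrix dot_square_norm matrix_vector_mul_assoc vector_transpose_matrix)
  moreover have "(norm (?J *v b))\<^sup>2 \<le> C\<^sup>2" using le by (simp add: power_mono)
  ultimately have sum: "lam 1 * (c 1)\<^sup>2 + lam 2 * (c 2)\<^sup>2 + lam 3 * (c 3)\<^sup>2 \<le> C\<^sup>2"
    using ordered_eigenframe_quadratic(1)[OF frame, of b] by (simp add: sum_3 c_def)
  have nrm: "(norm b)\<^sup>2 = (c 1)\<^sup>2 + (c 2)\<^sup>2 + (c 3)\<^sup>2"
    using ordered_eigenframe_quadratic(2)[OF frame, of b] by (simp add: sum_3 c_def dot_square_norm)
  have nonneg: "0 \<le> lam 1 * (c 1)\<^sup>2" "0 \<le> lam 2 * (c 2)\<^sup>2" "0 \<le> lam 3 * (c 3)\<^sup>2"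
    using ord by auto
  have "0 < norm b" using \<open>b \<noteq> 0\<close> by simp
  have "lam 3 * (norm b)\<^sup>2 \<le> lam 1 * (c 1)\<^sup>2 + lam 2 * (c 2)\<^sup>2 + lam 3 * (c 3)\<^sup>2"
    unfolding nrm distrib_left using ord by (intro add_mono mult_right_mono) auto
  with sum have "lam 3 * (norm b)\<^sup>2 \<le> C\<^sup>2" by linarith
  then show "lam 3 \<le> (C / norm b)\<^sup>2"
    using \<open>0 < norm b\<close> by (simp add: power_divide pos_le_divide_eq)
  have "det (label_gram_matrix A x t) = 1"
    by (simp add: label_gram_matrix_def det_mul det_transpose det)
  then have prod: "lam 1 * lam 2 * lam 3 = 1" using ordered_eigenframe_det[OF frame] by simp
  have "lam 1 * lam 2 * lam 3 \<le> lam 1 * lam 1 * lam 3"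
    using ord by (intro mult_right_mono mult_left_mono) auto
  then show sq: "1 \<le> lam 1 ^ 2 * lam 3" by (simp add: prod power2_eq_square)
  \<comment> \<open>Otherwise \<open>lam 1 ^ 2 * lam 3 \<le> lam 3 \<le> lam 1 < 1\<close>, against
    \<open>sq\<close>. This lets \<open>lam 1\<close> be dropped from the bound on
    \<open>c 1\<close>.\<close>
  have "1 \<le> lam 1"
  proof (rule ccontr)
    assume "\<not> 1 \<le> lam 1"
    then have "lam 1 ^ 2 * lam 3 \<le> 1 * lam 3"
      using ord by (intro mult_right_mono power_le_one) auto
    with sq ord \<open>\<not> 1 \<le> lam 1\<close> show False by linarith
  qed
  then have "1 * (c 1)\<^sup>2 \<le> lam 1 * (c 1)\<^sup>2" by (intro mult_right_mono) auto
  then have "(c 1)\<^sup>2 \<le> C\<^sup>2" using sum nonneg by linarith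
  moreover have "0 \<le> C" using le norm_ge_zero order_trans by blast
  ultimately have "\<bar>c 1\<bar> \<le> C" by (metis abs_le_square_iff abs_of_nonneg)
  then show "\<bar>(b /\<^sub>R norm b) \<bullet> e 1\<bar> \<le> C / norm b"
    using \<open>0 < norm b\<close>
    by (simp add: c_def inner_commute abs_mult divide_inverse_commute)
  have "lam 2 * (c 2)\<^sup>2 \<le> C\<^sup>2" using sum nonneg by linarith
  then have "lam 2 * (c 2)\<^sup>2 / (norm b)\<^sup>2 \<le> C\<^sup>2 / (norm b)\<^sup>2" by (rule divide_right_mono) simp
  moreover have "(b /\<^sub>R norm b) \<bullet> e 2 = c 2 / norm b"
    by (simp add: c_def inner_commute divide_inverse_commute)
  ultimately show "lam 2 * ((b /\<^sub>R norm b) \<bullet> e 2)\<^sup>2 \<le> (C / norm b)\<^sup>2"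
    by (simp add: power_divide)
qed

theorem theorem2p5:
  fixes T tbar :: ereal
    and v b X A :: "real^3 \<Rightarrow> real \<Rightarrow> real^3"
    and p :: "real^3 \<Rightarrow> real \<Rightarrow> real"
    and v0 b0 :: "real^3 \<Rightarrow> real^3"
    and lam :: "3 \<Rightarrow> real^3 \<Rightarrow> real \<Rightarrow> real"
    and e :: "3 \<Rightarrow> real^3 \<Rightarrow> real \<Rightarrow> real^3"
    and xk :: "nat \<Rightarrow> real^3" and tk :: "nat \<Rightarrow> real" and xbar :: "real^3"
  assumes "0 < T"
    and "\<And>x. divergence v0 x = 0" and "\<And>x. divergence b0 x = 0"
    and "smooth_ideal_mhd_solution T v0 b0 v b p"
    and "esssup lborel (\<lambda>x. ereal (norm (b0 x))) < \<infinity>"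
    and "particle_trajectory_map T v X"
    and "\<And>t. t \<in> time_interval T \<Longrightarrow> diffeomorphism (\<lambda>a. X a t)"
    and "A = back_to_label_map X"
    and "\<And>x t. t \<in> time_interval T \<Longrightarrow>
           ordered_eigenframe (label_gram_matrix A x t) (\<lambda>j. lam j x t) (\<lambda>j. e j x t)"
    and "\<And>k. tk k \<in> time_interval T"
    and "0 \<le> tbar" and "tbar \<le> T"
    and "xk \<longlonglongrightarrow> xbar" and "(\<lambda>k. ereal (tk k)) \<longlonglongrightarrow> tbar"
    and "filterlim (\<lambda>k. norm (b (xk k) (tk k))) at_top sequentially"
  shows "filterlim (\<lambda>k. lam 1 (xk k) (tk k)) at_top sequentially \<and>
    (\<lambda>k. lam 3 (xk k) (tk k)) \<longlonglongrightarrow> 0 \<and>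
    (\<lambda>k. magnetic_direction b (xk k) (tk k) \<bullet> e 1 (xk k) (tk k)) \<longlonglongrightarrow> 0 \<and>
    (liminf (\<lambda>k. ereal (lam 2 (xk k) (tk k))) > 0 \<longrightarrow>
      (\<lambda>k. magnetic_direction b (xk k) (tk k) \<bullet> e 2 (xk k) (tk k)) \<longlonglongrightarrow> 0)"
proof -
  let ?I = "time_interval T"
  let ?l = "\<lambda>j k. lam j (xk k) (tk k)"
  let ?c = "\<lambda>j k. magnetic_direction b (xk k) (tk k) \<bullet> e j (xk k) (tk k)"
  define \<beta> where "\<beta> = (\<lambda>k. norm (b (xk k) (tk k)))"
  have b0: "b0 x = b x 0" for x
    using assms(4) by (simp add: smooth_ideal_mhd_solution_def)
  \<comment> \<open>Makes \<open>b0\<close> a time slice of the continuous \<open>b\<close>, so that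
    its essential bound holds pointwise.\<close>
  have "0 \<in> ?I" using assms(1) by (simp add: time_interval_def zero_ereal_def)
  have "Ck_on 0 (UNIV \<times> ?I) (\<lambda>(x, t). b x t)"
    using assms(4) by (simp only: smooth_ideal_mhd_solution_def smooth_on_def)
  then have "continuous_on (UNIV \<times> ?I) (\<lambda>(x, t). b x t)" by simp
  moreover have "continuous_on UNIV (\<lambda>x :: real^3. (x, 0 :: real))"
    by (intro continuous_intros)
  ultimately have "continuous_on UNIV (\<lambda>x. (\<lambda>(x, t). b x t) (x, 0))"
    by (rule continuous_on_compose2) (use \<open>0 \<in> ?I\<close> in auto)
  then have "continuous_on UNIV b0" by (simp flip: b0)
  then obtain C where "0 < C" and C: "\<And>x. norm (b0 x) \<le> C"
    using continuous_esssup_bound assms(5) by blast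
  have transport: "norm (jacobian (\<lambda>y. A y t) (at x) *v b x t) \<le> C"
      "det (jacobian (\<lambda>y. A y t) (at x)) = 1" if "t \<in> ?I" for x t
    using label_map_transport[OF assms(4,6,7) that] C by (simp_all add: assms(8))
  have top: "filterlim \<beta> at_top sequentially" using assms(15) by (simp add: \<beta>_def)
  then have pos: "\<forall>\<^sub>F k in sequentially. 0 < \<beta> k" by (simp add: filterlim_at_top_dense)
  define q where "q = (\<lambda>k. C / \<beta> k)"
  have q: "q \<longlonglongrightarrow> 0"
    unfolding q_def using top
    by (intro tendsto_divide_0[OF tendsto_const] filterlim_at_top_imp_at_infinity)
  \<comment> \<open>Holds only eventually, once \<open>b\<close> is known to be nonzero at the
    sampled points.\<close>
  have bounds: "\<forall>\<^sub>F k in sequentially. ?l 3 k \<le> (q k)\<^sup>2 \<and> 1 \<le> (?l 1 k)\<^sup>2 * ?l 3 k \<and>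
      \<bar>?c 1 k\<bar> \<le> q k \<and> ?l 2 k * (?c 2 k)\<^sup>2 \<le> (q k)\<^sup>2"
    using pos
  proof eventually_elim
    case (elim k)
    then have "b (xk k) (tk k) \<noteq> 0" by (auto simp: \<beta>_def)
    from label_gram_matrix_bounds[OF assms(9) transport(2,1) this, OF assms(10,10,10)]
    show ?case by (simp only: q_def \<beta>_def magnetic_direction_def simp_thms)
  qed
  have ord: "?l 1 k \<ge> ?l 3 k" "?l 3 k > 0" for k
    using assms(9)[OF assms(10)[of k], of "xk k"] by (auto simp: ordered_eigenframe_def)
  have q2: "(\<lambda>k. (q k)\<^sup>2) \<longlonglongrightarrow> 0" using tendsto_power[OF q, of 2] by simp
  have l3: "?l 3 \<longlonglongrightarrow> 0"
  proof (rule tendsto_sandwich[OF _ _ tendsto_const q2])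
    show "\<forall>\<^sub>F k in sequentially. 0 \<le> ?l 3 k" using ord(2) by (simp add: less_imp_le)
    show "\<forall>\<^sub>F k in sequentially. ?l 3 k \<le> (q k)\<^sup>2" using bounds by (rule eventually_mono) blast
  qed
  have l1: "filterlim (?l 1) at_top sequentially"
  proof (rule filterlim_at_top_mono)
    show "filterlim (\<lambda>k. \<beta> k / C) at_top sequentially"
      using filterlim_tendsto_pos_mult_at_top[OF tendsto_const[of "1 / C"] _ top] \<open>0 < C\<close> by simp
    \<comment> \<open>Inserting \<open>lam 3 \<le> q\<^sup>2\<close> into
      \<open>1 \<le> lam 1 ^ 2 * lam 3\<close> and taking roots gives
      \<open>1 \<le> lam 1 * q\<close>.\<close>
    show "\<forall>\<^sub>F k in sequentially. \<beta> k / C \<le> ?l 1 k"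
      using bounds pos
    proof eventually_elim
      case (elim k)
      have "1 \<le> (?l 1 k)\<^sup>2 * ?l 3 k" using elim by blast
      also have "\<dots> \<le> (?l 1 k)\<^sup>2 * (q k)\<^sup>2" using elim by (intro mult_left_mono) auto
      finally have "1\<^sup>2 \<le> (?l 1 k * q k)\<^sup>2" by (simp add: power_mult_distrib)
      then have "1 \<le> ?l 1 k * q k"
        by (rule power2_le_imp_le) (use ord[of k] elim \<open>0 < C\<close> in \<open>simp add: q_def\<close>)
      with elim \<open>0 < C\<close> show ?case by (simp add: q_def field_simps)
    qed
  qed
  have c1: "?c 1 \<longlonglongrightarrow> 0"
    using bounds by (intro Lim_null_comparison[OF _ q]) (auto elim: eventually_mono)
  have c2: "?c 2 \<longlonglongrightarrow> 0" if liminf: "liminf (\<lambda>k. ereal (?l 2 k)) > 0"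
  proof -
    \<comment> \<open>A real number below the lower limit, which may be infinite; it bounds
      \<open>lam 2\<close> from below eventually and can be divided out.\<close>
    obtain \<delta> where "0 < \<delta>" and "ereal \<delta> < liminf (\<lambda>k. ereal (?l 2 k))"
      using ereal_dense2[OF liminf] by (auto simp: zero_ereal_def)
    then have "\<forall>\<^sub>F k in sequentially. \<delta> < ?l 2 k"
      using less_LiminfD by fastforce
    with bounds have "\<forall>\<^sub>F k in sequentially. norm ((?c 2 k)\<^sup>2) \<le> (q k)\<^sup>2 / \<delta>"
    proof eventually_elim
      case (elim k)
      have "\<delta> * (?c 2 k)\<^sup>2 \<le> ?l 2 k * (?c 2 k)\<^sup>2" using elim by (intro mult_right_mono) auto
      then have "\<delta> * (?c 2 k)\<^sup>2 \<le> (q k)\<^sup>2" using elim by linarith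
      with \<open>0 < \<delta>\<close> show ?case by (simp add: pos_le_divide_eq mult.commute)
    qed
    moreover have "(\<lambda>k. (q k)\<^sup>2 / \<delta>) \<longlonglongrightarrow> 0"
      using tendsto_divide[OF q2 tendsto_const[of \<delta>]] \<open>0 < \<delta>\<close> by simp
    ultimately have "(\<lambda>k. (?c 2 k)\<^sup>2) \<longlonglongrightarrow> 0" by (rule Lim_null_comparison)
    from tendsto_real_sqrt[OF this] show ?thesis by (simp add: tendsto_rabs_zero_iff)
  qed
  show ?thesis using l1 l3 c1 c2 by blast
qed

end
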